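(* Let $g\geq 1$ be an integer. Then $$\sum_{n=1}^{g}(g+1)^n\sum_{\substack{a_1+\cdots+a_n=g\\ a_i>0}}\ \prod_{j=1}^n\frac{|B_{2a_j}|}{a_j!\,(2a_j-1)!!\,(a_1+\cdots+a_j)}=\frac{g!}{(2g+1)!!},$$ where the inner sum is over ordered $n$-tuples $(a_1,\dots,a_n)$ of positive integers with sum $g$.
   Context: $B_m$ are the Bernoulli numbers defined by $\frac{t}{e^t-1}=\sum_{m\ge0}B_m\frac{t^m}{m!}$, and $(2a-1)!!=1\cdot3\cdots(2a-1)$. *)

theory Defs
  imports Complex_Main "HOL-Computational_Algebra.Computational_Algebra"
begin

text \<open>
  The quotient of formal power series below is exact: the numerator has zero constant
  coefficient and the denominator has subdegree 1 (see \<open>bernoulli_fps\<close>).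
\<close>
definition bernoulli :: "nat \<Rightarrow> real" where
  "bernoulli m = fact m * fps_nth (fps_X / (fps_exp 1 - 1)) m"

definition double_fact :: "nat \<Rightarrow> nat" where
  "double_fact m = \<Prod>{k \<in> {1..m}. even k \<longleftrightarrow> even m}"

text \<open>Tuples are lists, so the entry \<open>a\<^sub>j\<close> of the usual notation is \<open>a ! (j - 1)\<close>.\<close>
definition compositions :: "nat \<Rightarrow> nat \<Rightarrow> nat list set" where
  "compositions n g = {a. length a = n \<and> (\<forall>x\<in>set a. x > 0) \<and> sum_list a = g}"

lemma bernoulli_fps:
  "Abs_fps (\<lambda>m. bernoulli m / fact m) * (fps_exp 1 - 1) = fps_X"
proof -
  let ?d = "fps_exp (1::real) - 1"
  have sub: "subdegree ?d = 1"
    by (rule subdegreeI) auto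
  then have nz: "?d \<noteq> 0" by auto
  have "?d dvd fps_X"
    using nz sub by (simp add: fps_dvd_iff)
  moreover have "Abs_fps (\<lambda>m. bernoulli m / fact m) = fps_X / ?d"
    by (simp add: fps_eq_iff bernoulli_def)
  ultimately show ?thesis by simp
qed

lemma double_fact_odd: "double_fact (2 * a - 1) = (\<Prod>i=1..a. 2 * i - 1)"
proof (cases "a = 0")
  case False
  have "bij_betw (\<lambda>i. 2 * i - 1) {1..a} {k \<in> {1..2 * a - 1}. even k \<longleftrightarrow> even (2 * a - 1)}"
    by (rule bij_betw_byWitness[where f' = "\<lambda>k. (k + 1) div 2"])
       (use False in \<open>auto elim!: oddE\<close>)
  from prod.reindex_bij_betw[OF this, of "\<lambda>k. k"] show ?thesis
    by (simp add: double_fact_def)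
qed (simp add: double_fact_def)

lemma finite_compositions: "finite (compositions n g)"
proof (rule finite_subset)
  show "compositions n g \<subseteq> {a. set a \<subseteq> {..g} \<and> length a = n}"
    by (auto simp: compositions_def member_le_sum_list)
qed (simp add: finite_lists_length_eq)

end

theory Submission
  imports Defs
begin

text \<open>
  Write \<open>w a = \<bar>B\<^bsub>2a\<^esub>\<bar> / (a! (2a-1)!!) = 2\<^sup>a \<bar>B\<^bsub>2a\<^esub>\<bar> / (2a)!\<close> and \<open>\<theta> = t d/dt\<close>.
  A sum over compositions in which every entry is weighted by \<open>x w a\<close> and every partial sum
  by its reciprocal is a coefficient of the solution \<open>F\<close> of \<open>\<theta> F = x (\<Sum>a. w a t\<^sup>a) F\<close> with
  \<open>F(0) = 1\<close>: comparing coefficients of \<open>t\<^sup>g\<close> splits off the last entry of a composition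
  (\<open>composition_sum_recurrence_solution\<close>). If \<open>\<phi>\<close> solves this for \<open>x = 1\<close>, then
  \<open>F = \<phi>\<^sup>x\<close>, so the left-hand side of the theorem is the coefficient of \<open>t\<^sup>g\<close> in
  \<open>\<phi>\<^bsup>g+1\<^esup>\<close>.

  Here \<open>\<phi>\<close> is explicit. With \<open>s\<^sup>2 = 2t\<close> the expansion of the cotangent gives
  \<open>1 - \<Sum>a. w a t\<^sup>a = (s/2) cot (s/2) = h\<close>, and integrating \<open>\<theta> \<phi> = (1 - h) \<phi>\<close> yields
  \<open>\<phi> = ((s/2) / sin (s/2))\<^sup>2\<close>. The Pythagorean identity becomes \<open>\<phi> = h\<^sup>2 + t/2\<close>, and the
  derivative of the cotangent becomes \<open>2 \<theta> h = h - \<phi>\<close>.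

  By Lagrange inversion the coefficient of \<open>t\<^sup>g\<close> in \<open>\<phi>\<^bsup>g+1\<^esup>\<close> is \<open>g + 1\<close> times the coefficient
  of \<open>y\<^bsup>g+1\<^esup>\<close> in the inverse of \<open>t/\<phi> = 1 - cos s\<close>, half a squared arc cosine. The proof below
  stays with \<open>\<phi>\<close> instead: \<open>\<theta>\<close> multiplies the coefficient of \<open>t\<^sup>n\<close> by \<open>n\<close>, and applied to
  \<open>\<phi>\<^sup>n\<close> and \<open>h \<phi>\<^sup>n\<close> this gives the first-order recurrence
  \<open>(2n+1) [t\<^sup>n] \<phi>\<^bsup>n+1\<^esup> = n [t\<^bsup>n-1\<^esup>] \<phi>\<^sup>n\<close> (\<open>riccati_power_coeff\<close>), whose solution is
  \<open>g! / (2g+1)!!\<close>.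

  What is needed about Bernoulli numbers is one Riccati equation. It comes from
  differentiating \<open>B(u) (e\<^sup>u - 1) = u\<close> for their generating series \<open>B(u)\<close>, and it also shows that \<open>B\<^sub>n = 0\<close> for odd \<open>n > 1\<close> and that
  the signs of the \<open>B\<^bsub>2a\<^esub>\<close> alternate, so that the absolute values in \<open>w\<close> amount to passing
  from the hyperbolic to the trigonometric cotangent.
\<close>

section \<open>Weighted compositions\<close>

definition composition_sum :: "(nat \<Rightarrow> 'a::field_char_0) \<Rightarrow> nat \<Rightarrow> nat \<Rightarrow> 'a" where
  "composition_sum w n g =
     (\<Sum>a\<in>compositions n g. \<Prod>j<n. w (a ! j) / of_nat (\<Sum>i\<le>j. a ! i))"

lemma composition_sum_0: "composition_sum w 0 g = (if g = 0 then 1 else 0)"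
proof -
  have "compositions 0 g = (if g = 0 then {[]} else {})"
    by (auto simp: compositions_def)
  then show ?thesis by (simp add: composition_sum_def)
qed

lemma length_le_sum_list: "\<forall>x\<in>set a. x > 0 \<Longrightarrow> length a \<le> sum_list (a :: nat list)"
  by (induction a) auto

lemma composition_sum_eq_0: "g < n \<Longrightarrow> composition_sum w n g = 0"
proof -
  assume "g < n"
  then have "compositions n g = {}"
    using length_le_sum_list by (fastforce simp: compositions_def)
  then show ?thesis by (simp add: composition_sum_def)
qed

lemma compositions_Suc:
  "compositions (Suc n) g = (\<Union>b\<in>{1..g}. (\<lambda>a. a @ [b]) ` compositions n (g - b))"
proof (intro equalityI subsetI)
  fix a assume a: "a \<in> compositions (Suc n) g"
  then obtain a' b where ab: "a = a' @ [b]"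
    by (cases a rule: rev_cases) (auto simp: compositions_def)
  with a have "b \<in> {1..g}" "a' \<in> compositions n (g - b)"
    by (auto simp: compositions_def)
  with ab show "a \<in> (\<Union>b\<in>{1..g}. (\<lambda>a. a @ [b]) ` compositions n (g - b))" by blast
qed (auto simp: compositions_def)

text \<open>
  The last partial sum of a composition of \<open>g\<close> is \<open>g\<close>, and the earlier ones do not see the last
  entry \<open>b\<close>; hence removing \<open>b\<close> removes exactly the factor \<open>w b / g\<close>.
\<close>
lemma composition_sum_Suc:
  "composition_sum w (Suc n) g = (\<Sum>b=1..g. w b * composition_sum w n (g - b)) / of_nat g"
proof -
  let ?t = "\<lambda>n a. \<Prod>j<n. w (a ! j) / of_nat (\<Sum>i\<le>j. a ! i)"
  have snoc: "?t (Suc n) (a @ [b]) = w b * ?t n a / of_nat g"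
    if "b \<in> {1..g}" and "a \<in> compositions n (g - b)" for a b
  proof -
    from that have len: "length a = n" and sum: "sum_list a = g - b" and "b \<le> g"
      by (auto simp: compositions_def)
    have prefix: "(\<Sum>i\<le>j. (a @ [b]) ! i) = (\<Sum>i\<le>j. a ! i)" if "j < n" for j
      by (rule sum.cong) (use that len in \<open>auto simp: nth_append\<close>)
    have "(\<Sum>i\<le>n. (a @ [b]) ! i) = sum_list (a @ [b])"
      unfolding sum_list_sum_nth using len by (intro sum.cong) auto
    also have "\<dots> = g" using sum \<open>b \<le> g\<close> by simp
    finally have total: "(\<Sum>i\<le>n. (a @ [b]) ! i) = g" .
    have "?t n (a @ [b]) = ?t n a"
      by (rule prod.cong) (use prefix len in \<open>auto simp: nth_append\<close>)
    moreover have "(a @ [b]) ! n = b" using len by auto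
    ultimately show ?thesis by (simp only: prod.lessThan_Suc total) simp
  qed
  have "composition_sum w (Suc n) g =
          (\<Sum>b=1..g. \<Sum>a\<in>(\<lambda>a. a @ [b]) ` compositions n (g - b). ?t (Suc n) a)"
    unfolding composition_sum_def compositions_Suc
    by (rule sum.UNION_disjoint) (auto simp: finite_compositions)
  also have "\<dots> = (\<Sum>b=1..g. \<Sum>a\<in>compositions n (g - b). ?t (Suc n) (a @ [b]))"
    by (rule sum.cong[OF refl], subst sum.reindex) (auto simp: inj_on_def)
  also have "\<dots> = (\<Sum>b=1..g. \<Sum>a\<in>compositions n (g - b). w b * ?t n a / of_nat g)"
    by (intro sum.cong refl snoc)
  also have "\<dots> = (\<Sum>b=1..g. w b * composition_sum w n (g - b)) / of_nat g"
    by (simp add: composition_sum_def sum_distrib_left sum_divide_distrib)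
  finally show ?thesis .
qed

text \<open>
  The recurrence is \<open>\<theta> F = x (\<Sum>a. w a t\<^sup>a) F\<close> in coefficients, so the lemma expands
  \<open>exp (x \<Sum>a. w a t\<^sup>a / a)\<close> as a sum over compositions. Unrolling the recurrence down to
  \<open>F 0\<close> picks the entries of a composition from the last to the first.
\<close>
lemma composition_sum_recurrence_solution:
  fixes x :: "'a::field_char_0"
  assumes F0: "F 0 = 1"
    and rec: "\<And>n. of_nat n * F n = x * (\<Sum>b=1..n. w b * F (n - b))"
  shows "F g = (\<Sum>n\<le>g. x ^ n * composition_sum w n g)"
proof (induction g rule: less_induct)
  case (less g)
  show ?case
  proof (cases g)
    case 0
    then show ?thesis by (simp add: F0 composition_sum_0)
  next
    case (Suc m)
    have IH: "F (g - b) = (\<Sum>n\<le>m. x ^ n * composition_sum w n (g - b))" if "b \<in> {1..g}" for b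
    proof -
      have "F (g - b) = (\<Sum>n\<le>g - b. x ^ n * composition_sum w n (g - b))"
        using that by (intro less) auto
      also have "\<dots> = (\<Sum>n\<le>m. x ^ n * composition_sum w n (g - b))"
        by (rule sum.mono_neutral_left) (use that Suc in \<open>auto simp: composition_sum_eq_0\<close>)
      finally show ?thesis .
    qed
    have "F g = x * (\<Sum>b=1..g. w b * F (g - b)) / of_nat g"
      using rec[of g] Suc by (simp add: field_simps del: of_nat_Suc)
    also have "\<dots> = x * (\<Sum>b=1..g. w b * (\<Sum>n\<le>m. x ^ n * composition_sum w n (g - b))) / of_nat g"
      by (simp add: IH cong: sum.cong_simp)
    also have "\<dots> = x * (\<Sum>b=1..g. \<Sum>n\<le>m. x ^ n * (w b * composition_sum w n (g - b))) / of_nat g"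
      by (simp add: sum_distrib_left mult.left_commute)
    also have "\<dots> = x * (\<Sum>n\<le>m. x ^ n * (\<Sum>b=1..g. w b * composition_sum w n (g - b))) / of_nat g"
      by (subst sum.swap) (simp add: sum_distrib_left)
    also have "\<dots> = (\<Sum>n\<le>m. x ^ Suc n * composition_sum w (Suc n) g)"
      unfolding composition_sum_Suc by (simp add: sum_distrib_left sum_divide_distrib mult.assoc)
    also have "\<dots> = (\<Sum>n\<le>g. x ^ n * composition_sum w n g)"
      unfolding Suc by (subst sum.atMost_Suc_shift) (simp add: composition_sum_0)
    finally show ?thesis .
  qed
qed

section \<open>Coefficients from a Riccati equation\<close>

lemma fps_X_deriv_nth: "(fps_X * fps_deriv f) $ n = of_nat n * (f $ n :: 'a::comm_ring_1)"
  by (cases n) simp_all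

text \<open>
  In terms of \<open>P = t/\<phi>\<close>, the coefficient of \<open>t\<^bsup>n-1\<^esup>\<close> in \<open>\<phi>\<^sup>n\<close> is the residue of \<open>P\<^bsup>-n\<^esup>\<close>, and
  the recurrence expresses that the derivatives of \<open>P\<^bsup>-n\<^esup>\<close> and of \<open>h P\<^bsup>-n\<^esup>\<close> have residue \<open>0\<close>.
  The hypotheses make \<open>\<theta> (h \<phi>\<^sup>n)\<close> a combination of \<open>h \<phi>\<^sup>n\<close>, \<open>\<phi>\<^bsup>n+1\<^esup>\<close> and \<open>t \<phi>\<^sup>n\<close>.
\<close>
lemma riccati_power_coeff:
  fixes h \<phi> :: "'a::field_char_0 fps"
  assumes h: "2 * (fps_X * fps_deriv h) = h - \<phi>"
    and \<phi>: "fps_X * fps_deriv \<phi> = (1 - h) * \<phi>"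
    and hh: "2 * \<phi> = 2 * h\<^sup>2 + fps_X"
    and "n > 0"
  shows "of_nat (2 * n + 1) * (\<phi> ^ Suc n) $ n = of_nat n * (\<phi> ^ n) $ (n - 1)"
proof -
  have \<theta>pow: "fps_X * fps_deriv (\<phi> ^ n) = of_nat n * ((1 - h) * \<phi> ^ n)"
  proof -
    have "fps_X * fps_deriv (\<phi> ^ n) = of_nat n * (fps_X * fps_deriv \<phi>) * \<phi> ^ (n - 1)"
      by (simp add: fps_deriv_power fps_of_nat algebra_simps)
    also have "\<dots> = of_nat n * ((1 - h) * (\<phi> * \<phi> ^ (n - 1)))"
      unfolding \<phi> by (simp add: algebra_simps)
    finally show ?thesis using \<open>n > 0\<close> by (simp add: power_eq_if)
  qed
  \<comment> \<open>The factor \<open>n\<close> produced by \<open>\<theta>\<close> on the left is the one produced by the power rule on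
    the right; this is where the exponent and the index of the coefficient have to agree.\<close>
  have hpow0: "(h * \<phi> ^ n) $ n = 0"
  proof -
    have "of_nat n * (\<phi> ^ n) $ n = of_nat n * (((1 - h) * \<phi> ^ n) $ n)"
      using arg_cong[OF \<theta>pow, of "\<lambda>f. f $ n"] 
      unfolding fps_X_deriv_nth by (simp add: fps_of_nat[symmetric] del: fps_of_nat)
    then have "(\<phi> ^ n) $ n = ((1 - h) * \<phi> ^ n) $ n"
      using \<open>n > 0\<close> by simp
    then show ?thesis by (simp add: algebra_simps)
  qed
  have "2 * (fps_X * fps_deriv (h * \<phi> ^ n)) =
          2 * (fps_X * fps_deriv h) * \<phi> ^ n + 2 * h * (fps_X * fps_deriv (\<phi> ^ n))"
    by (simp add: algebra_simps)
  also have "\<dots> = (h - \<phi>) * \<phi> ^ n + of_nat n * ((2 * h - 2 * h\<^sup>2) * \<phi> ^ n)"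
    unfolding \<theta>pow h by (simp add: algebra_simps power2_eq_square)
  also have "2 * h\<^sup>2 = 2 * \<phi> - fps_X"
    using hh by simp
  also have "(h - \<phi>) * \<phi> ^ n + of_nat n * ((2 * h - (2 * \<phi> - fps_X)) * \<phi> ^ n) =
      of_nat (2 * n + 1) * (h * \<phi> ^ n) - of_nat (2 * n + 1) * \<phi> ^ Suc n
        + of_nat n * (fps_X * \<phi> ^ n)"
    by (simp add: algebra_simps)
  finally have eq: "of_nat 2 * (fps_X * fps_deriv (h * \<phi> ^ n)) =
      of_nat (2 * n + 1) * (h * \<phi> ^ n) - of_nat (2 * n + 1) * \<phi> ^ Suc n
        + of_nat n * (fps_X * \<phi> ^ n)" by simp
  have c: "(of_nat k * f) $ m = of_nat k * f $ m" for k m and f :: "'a fps"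
    by (simp add: fps_of_nat[symmetric] del: fps_of_nat)
  have "0 = - (of_nat (2 * n + 1) * (\<phi> ^ Suc n) $ n) + of_nat n * (\<phi> ^ n) $ (n - 1)"
    using arg_cong[OF eq, of "\<lambda>f. f $ n"] \<open>n > 0\<close>
    unfolding c fps_add_nth fps_sub_nth fps_X_deriv_nth hpow0
    by (simp del: power_Suc)
  then show ?thesis by (simp add: algebra_simps)
qed

lemma double_fact_odd_Suc: "double_fact (2 * Suc a - 1) = (2 * a + 1) * double_fact (2 * a - 1)"
  unfolding double_fact_odd by simp

lemma fact_double: "fact (2 * a) = 2 ^ a * fact a * double_fact (2 * a - 1)"
proof (induction a)
  case 0
  show ?case by (simp add: double_fact_def)
next
  case (Suc a)
  then show ?case
    unfolding double_fact_odd_Suc by (simp add: algebra_simps)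
qed

section \<open>Riccati equations for Bernoulli numbers\<close>

text \<open>The series of \<open>u/(e\<^sup>u - 1) + u/2 = (u/2) coth (u/2)\<close>.\<close>
definition bernoulli_even_fps :: "real fps" where
  "bernoulli_even_fps = Abs_fps (\<lambda>m. bernoulli m / fact m) + fps_const (1/2) * fps_X"

lemma bernoulli_even_fps_riccati:
  "fps_X * fps_deriv bernoulli_even_fps =
     bernoulli_even_fps - bernoulli_even_fps\<^sup>2 + fps_const (1/4) * fps_X\<^sup>2"
proof -
  define B where "B = Abs_fps (\<lambda>m. bernoulli m / fact m)"
  let ?e = "fps_exp (1::real)" and ?c = "fps_const (1/2 :: real)"
  have B: "B * ?e = fps_X + B"
    using bernoulli_fps by (simp add: B_def algebra_simps)
  have B': "fps_deriv B * ?e + B * ?e = 1 + fps_deriv B"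
    using arg_cong[OF B, of fps_deriv] by (simp add: algebra_simps)
  \<comment> \<open>Replacing \<open>u\<close> by \<open>B e\<^sup>u - B\<close> lets the exponential be eliminated without cancelling a factor.\<close>
  have "fps_X * fps_deriv B = (B * ?e - B) * fps_deriv B"
    unfolding B by simp
  also have "\<dots> = B * (fps_deriv B * ?e + B * ?e) - B * (B * ?e) - B * fps_deriv B"
    by (simp add: algebra_simps)
  also have "\<dots> = B - B * fps_X - B\<^sup>2"
    unfolding B' unfolding B by (simp add: algebra_simps power2_eq_square)
  finally have XB: "fps_X * fps_deriv B = B - B * fps_X - B\<^sup>2" .
  have c2: "2 * ?c = 1" and c4: "fps_const (1/4) = ?c * ?c"
    by (simp_all add: numeral_fps_const)
  have K: "bernoulli_even_fps = B + ?c * fps_X" 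
    by (simp add: bernoulli_even_fps_def B_def)
  show ?thesis
    unfolding K c4 using XB
    by (simp add: algebra_simps power2_eq_square c2 del: fps_const_mult)
qed

lemma square_nth:
  fixes f :: "'a::comm_ring_1 fps"
  assumes "f $ 0 = 1" "n > 0"
  shows "(f\<^sup>2) $ n = 2 * f $ n + (\<Sum>i=1..<n. f $ i * f $ (n - i))"
proof -
  have "(f\<^sup>2) $ n = (\<Sum>i=0..n. f $ i * f $ (n - i))"
    by (simp add: power2_eq_square fps_mult_nth)
  also have "{0..n} = insert 0 (insert n {1..<n})" using assms by auto
  finally show ?thesis using assms by simp
qed

lemma bernoulli_even_fps_0: "bernoulli_even_fps $ 0 = 1"
  using arg_cong[OF bernoulli_fps, of "\<lambda>f. f $ 1"]
  by (simp add: bernoulli_even_fps_def)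

text \<open>
  For odd \<open>n\<close> one of the indices in every product \<open>K\<^sub>i K\<^bsub>n-i\<^esub>\<close> is odd, and the Riccati
  equation has no inhomogeneous term in degree \<open>n\<close>.
\<close>
lemma bernoulli_even_fps_odd: "odd n \<Longrightarrow> bernoulli_even_fps $ n = 0"
proof (induction n rule: less_induct)
  case (less n)
  let ?K = bernoulli_even_fps
  have "n > 0" using less.prems by (rule odd_pos)
  have zero: "(\<Sum>i=1..<n. ?K $ i * ?K $ (n - i)) = 0"
  proof (intro sum.neutral ballI)
    fix i assume "i \<in> {1..<n}"
    then show "?K $ i * ?K $ (n - i) = 0"
      using less by (cases "odd i") auto
  qed
  have "real n * ?K $ n = ?K $ n - (?K\<^sup>2) $ n"
    using arg_cong[OF bernoulli_even_fps_riccati, of "\<lambda>f. f $ n"] less.prems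
    unfolding fps_X_deriv_nth by (auto simp: fps_X_power_iff)
  also have "(?K\<^sup>2) $ n = 2 * ?K $ n"
    unfolding square_nth[OF bernoulli_even_fps_0 \<open>n > 0\<close>] zero by simp
  finally have "(real n + 1) * ?K $ n = 0" by (simp add: algebra_simps)
  then show ?case by simp
qed

text \<open>
  The series of \<open>(s/2) cot (s/2)\<close> in the variable \<open>t = s\<^sup>2/2\<close>: substitute \<open>u = \<i> s\<close>, so that
  \<open>u\<^sup>2 = - 2 t\<close>, in \<open>(u/2) coth (u/2)\<close>.
\<close>
definition cot_fps :: "real fps" where
  "cot_fps = Abs_fps (\<lambda>a. (- 2) ^ a * bernoulli_even_fps $ (2 * a))"

text \<open>
  The equation of \<open>bernoulli_even_fps_riccati\<close> under \<open>u\<^sup>2 = - 2 t\<close>, which turns \<open>u d/du\<close> into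
  \<open>2 t d/dt\<close>.
\<close>
lemma cot_fps_riccati:
  "2 * (fps_X * fps_deriv cot_fps) = cot_fps - cot_fps\<^sup>2 - fps_const (1/2) * fps_X"
proof (rule fps_ext)
  fix a
  let ?K = bernoulli_even_fps
  have "(?K\<^sup>2) $ (2 * a) = (\<Sum>i=0..2 * a. ?K $ i * ?K $ (2 * a - i))"
    by (simp add: power2_eq_square fps_mult_nth)
  also have "\<dots> = (\<Sum>i\<in>(\<lambda>j. 2 * j) ` {0..a}. ?K $ i * ?K $ (2 * a - i))"
  proof (rule sum.mono_neutral_right)
    show "\<forall>i\<in>{0..2 * a} - (\<lambda>j. 2 * j) ` {0..a}. ?K $ i * ?K $ (2 * a - i) = 0"
    proof
      fix i assume i: "i \<in> {0..2 * a} - (\<lambda>j. 2 * j) ` {0..a}"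
      then have "odd i" by (auto elim!: evenE)
      then show "?K $ i * ?K $ (2 * a - i) = 0" by (simp add: bernoulli_even_fps_odd)
    qed
  qed auto
  also have "\<dots> = (\<Sum>j=0..a. ?K $ (2 * j) * ?K $ (2 * (a - j)))"
    by (subst sum.reindex) (auto simp: inj_on_def diff_mult_distrib2)
  finally have "(- 2) ^ a * (?K\<^sup>2) $ (2 * a) =
      (\<Sum>j=0..a. (- 2) ^ (j + (a - j)) * (?K $ (2 * j) * ?K $ (2 * (a - j))))"
    by (simp add: sum_distrib_left)
  also have "\<dots> = (cot_fps\<^sup>2) $ a"
    unfolding power2_eq_square fps_mult_nth cot_fps_def power_add
    by (intro sum.cong) (simp_all add: mult_ac)
  finally have sq: "(- 2) ^ a * (?K\<^sup>2) $ (2 * a) = (cot_fps\<^sup>2) $ a" .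
  have "(2 * (fps_X * fps_deriv cot_fps)) $ a = (- 2) ^ a * ((fps_X * fps_deriv ?K) $ (2 * a))"
    unfolding fps_X_deriv_nth
    by (simp add: numeral_fps_const fps_X_deriv_nth cot_fps_def del: fps_X_mult_nth)
  also have "\<dots> = (- 2) ^ a * ?K $ (2 * a) - (- 2) ^ a * (?K\<^sup>2) $ (2 * a)
                    + (- 2) ^ a * (if a = 1 then 1 / 4 else 0)"
    unfolding bernoulli_even_fps_riccati by (simp add: fps_X_power_iff algebra_simps)
  also have "\<dots> = (cot_fps - cot_fps\<^sup>2 - fps_const (1/2) * fps_X) $ a"
    unfolding sq by (cases "a = 1") (simp_all add: cot_fps_def)
  finally show "(2 * (fps_X * fps_deriv cot_fps)) $ a =
    (cot_fps - cot_fps\<^sup>2 - fps_const (1/2) * fps_X) $ a" .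
qed

lemma cot_fps_0: "cot_fps $ 0 = 1"
  by (simp add: cot_fps_def bernoulli_even_fps_0)

text \<open>
  The Riccati equation makes \<open>(2a+1) h\<^sub>a\<close> minus a sum of products \<open>h\<^sub>i h\<^bsub>a-i\<^esub>\<close> of two smaller
  coefficients, each positive by induction; for \<open>a = 1\<close> the sum is empty and the inhomogeneous
  term \<open>- t/2\<close> supplies the sign. Since \<open>h\<^sub>a = (-2)\<^sup>a B\<^bsub>2a\<^esub> / (2a)!\<close>, this is the
  alternation of the signs of the Bernoulli numbers.
\<close>
lemma cot_fps_neg: "a > 0 \<Longrightarrow> cot_fps $ a < 0"
proof (induction a rule: less_induct)
  case (less a)
  have "2 * (real a * cot_fps $ a) = cot_fps $ a - (cot_fps\<^sup>2) $ a - (if a = 1 then 1/2 else 0)"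
    using arg_cong[OF cot_fps_riccati, of "\<lambda>f. f $ a"]
    by (simp add: numeral_fps_const fps_X_deriv_nth del: fps_X_mult_nth)
  then have rec: "(2 * real a + 1) * cot_fps $ a =
      - ((\<Sum>i=1..<a. cot_fps $ i * cot_fps $ (a - i)) + (if a = 1 then 1/2 else 0))"
    by (simp add: square_nth cot_fps_0 less.prems algebra_simps)
  have pos: "cot_fps $ i * cot_fps $ (a - i) > 0" if "i \<in> {1..<a}" for i
    using that less.IH by (intro mult_neg_neg) auto
  have "(\<Sum>i=1..<a. cot_fps $ i * cot_fps $ (a - i)) + (if a = 1 then 1/2 else 0) > 0"
  proof (cases "a = 1")
    case False
    with less.prems have "{1..<a} \<noteq> {}" by simp
    with pos have "(\<Sum>i=1..<a. cot_fps $ i * cot_fps $ (a - i)) > 0"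
      by (intro sum_pos) auto
    with False show ?thesis by simp
  qed simp
  with rec have "(2 * real a + 1) * cot_fps $ a < 0" by linarith
  then show ?case by (simp add: mult_less_0_iff)
qed

lemma cot_fps_nth:
  assumes "a > 0"
  shows "cot_fps $ a = - (\<bar>bernoulli (2 * a)\<bar> / (fact a * real (double_fact (2 * a - 1))))"
proof -
  have "cot_fps $ a = - \<bar>cot_fps $ a\<bar>"
    using cot_fps_neg[OF assms] by simp
  also have "\<dots> = - (2 ^ a * \<bar>bernoulli (2 * a)\<bar> / fact (2 * a))"
    using assms by (simp add: cot_fps_def bernoulli_even_fps_def abs_mult power_abs)
  also have "fact (2 * a) = real (2 ^ a * fact a * double_fact (2 * a - 1))"
    unfolding fact_double[symmetric] by simp
  also have "2 ^ a * \<bar>bernoulli (2 * a)\<bar> / \<dots> =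
      \<bar>bernoulli (2 * a)\<bar> / (fact a * real (double_fact (2 * a - 1)))"
    by (simp add: mult.assoc)
  finally show ?thesis .
qed

text \<open>
  The series of \<open>((s/2) / sin (s/2))\<^sup>2\<close> in \<open>t = s\<^sup>2/2\<close>, by \<open>1 / sin\<^sup>2 = cot\<^sup>2 + 1\<close>.
\<close>
definition cosec_sq_fps :: "real fps" where
  "cosec_sq_fps = cot_fps\<^sup>2 + fps_const (1/2) * fps_X"

lemma double_half: "2 * (fps_const (1/2) * f) = (f :: real fps)"
  by (simp add: numeral_fps_const mult.assoc[symmetric])

lemma cot_fps_deriv: "2 * (fps_X * fps_deriv cot_fps) = cot_fps - cosec_sq_fps"
  by (simp add: cot_fps_riccati cosec_sq_fps_def)

lemma cosec_sq_fps_deriv: "fps_X * fps_deriv cosec_sq_fps = (1 - cot_fps) * cosec_sq_fps"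
proof -
  have "fps_X * fps_deriv cosec_sq_fps =
      cot_fps * (2 * (fps_X * fps_deriv cot_fps)) + fps_const (1/2) * fps_X"
    by (simp add: cosec_sq_fps_def power2_eq_square algebra_simps)
  also have "\<dots> = (1 - cot_fps) * cosec_sq_fps"
    unfolding cot_fps_deriv by (simp add: cosec_sq_fps_def power2_eq_square algebra_simps)
  finally show ?thesis .
qed

lemma cosec_sq_fps_0: "cosec_sq_fps $ 0 = 1"
  by (simp add: cosec_sq_fps_def cot_fps_0 power2_eq_square)

lemma cosec_sq_fps_power_coeff: "(cosec_sq_fps ^ Suc g) $ g = fact g / real (double_fact (2 * g + 1))"
proof (induction g)
  case 0
  show ?case using double_fact_odd[of 1] by (simp add: cosec_sq_fps_0)
next
  case (Suc g)
  have "2 * cosec_sq_fps = 2 * cot_fps\<^sup>2 + fps_X"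
    by (simp add: cosec_sq_fps_def distrib_left double_half)
  from riccati_power_coeff[OF cot_fps_deriv cosec_sq_fps_deriv this, of "Suc g"]
  have "real (2 * Suc g + 1) * (cosec_sq_fps ^ Suc (Suc g)) $ Suc g =
      real (Suc g) * (cosec_sq_fps ^ Suc g) $ g"
    by (simp del: power_Suc of_nat_Suc)
  also have "\<dots> = fact (Suc g) / real (double_fact (2 * g + 1))"
    unfolding Suc.IH by simp
  finally have "(cosec_sq_fps ^ Suc (Suc g)) $ Suc g =
      fact (Suc g) / real (double_fact (2 * g + 1)) / real (2 * Suc g + 1)"
    by (subst nonzero_eq_divide_eq) (simp_all add: mult.commute del: power_Suc of_nat_Suc fact_Suc)
  also have "\<dots> = fact (Suc g) / (real (2 * Suc g + 1) * real (double_fact (2 * g + 1)))"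
    by (simp only: divide_divide_eq_left mult.commute)
  also have "real (2 * Suc g + 1) * real (double_fact (2 * g + 1)) = real (double_fact (2 * Suc g + 1))"
    using double_fact_odd_Suc[of "Suc g"] by (simp add: algebra_simps)
  finally show ?case .
qed

text \<open>
  This is \<open>\<theta> \<phi>\<^sup>k = k (1 - h) \<phi>\<^sup>k\<close> in coefficients; it makes \<open>\<phi>\<^sup>k\<close> the series whose
  coefficients are the composition sums with weights \<open>- h\<^sub>b\<close>.
\<close>
lemma cosec_sq_fps_power_recurrence:
  "real n * (cosec_sq_fps ^ k) $ n = real k * (\<Sum>b=1..n. - cot_fps $ b * (cosec_sq_fps ^ k) $ (n - b))"
proof (cases k)
  case (Suc m)
  have "fps_X * fps_deriv (cosec_sq_fps ^ k) =
      fps_const (real k) * (fps_X * fps_deriv cosec_sq_fps) * cosec_sq_fps ^ m"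
    by (simp add: fps_deriv_power Suc algebra_simps del: power_Suc)
  also have "\<dots> = fps_const (real k) * ((1 - cot_fps) * cosec_sq_fps ^ k)"
    unfolding cosec_sq_fps_deriv by (simp add: Suc algebra_simps)
  finally have "real n * (cosec_sq_fps ^ k) $ n = real k * ((1 - cot_fps) * cosec_sq_fps ^ k) $ n"
    by (metis fps_X_deriv_nth fps_mult_left_const_nth)
  also have "((1 - cot_fps) * cosec_sq_fps ^ k) $ n =
      (\<Sum>b=0..n. (1 - cot_fps) $ b * (cosec_sq_fps ^ k) $ (n - b))"
    by (rule fps_mult_nth)
  also have "\<dots> = (\<Sum>b=1..n. - cot_fps $ b * (cosec_sq_fps ^ k) $ (n - b))"
    by (simp add: sum.atLeast_Suc_atMost cot_fps_0)
  finally show ?thesis .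
qed (cases n; simp)

theorem proposition4p7:
  fixes g :: nat
  assumes "g \<ge> 1"
  shows "(\<Sum>n=1..g. (real g + 1) ^ n *
           (\<Sum>a\<in>compositions n g.
              \<Prod>j<n. \<bar>bernoulli (2 * a ! j)\<bar> /
                     (fact (a ! j) * real (double_fact (2 * a ! j - 1)) * real (\<Sum>i\<le>j. a ! i))))
         = fact g / real (double_fact (2 * g + 1))"
proof -
  define w where "w a = \<bar>bernoulli (2 * a)\<bar> / (fact a * real (double_fact (2 * a - 1)))" for a
  have "fact g / real (double_fact (2 * g + 1)) = (cosec_sq_fps ^ Suc g) $ g"
    by (rule cosec_sq_fps_power_coeff[symmetric])
  also have "\<dots> = (\<Sum>n\<le>g. real (Suc g) ^ n * composition_sum w n g)"
  proof (rule composition_sum_recurrence_solution[where F = "\<lambda>n. (cosec_sq_fps ^ Suc g) $ n"])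
    show "(cosec_sq_fps ^ Suc g) $ 0 = 1"
      by (simp add: fps_power_zeroth cosec_sq_fps_0)
    show "real n * (cosec_sq_fps ^ Suc g) $ n =
        real (Suc g) * (\<Sum>b=1..n. w b * (cosec_sq_fps ^ Suc g) $ (n - b))" for n
      unfolding cosec_sq_fps_power_recurrence[of n]
      by (simp add: w_def cot_fps_nth del: power_Suc of_nat_Suc cong: sum.cong_simp)
  qed
  also have "\<dots> = (\<Sum>n=1..g. (real g + 1) ^ n * composition_sum w n g)"
    using assms by (intro sum.mono_neutral_cong_right)
      (auto simp: composition_sum_0 not_less_eq_eq add.commute)
  finally show ?thesis
    by (simp add: composition_sum_def w_def)
qed

end
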